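(* Let $p\ge2$, let $m_1,\dots,m_p$ be positive integers, and let $P_1=(x_1,\dots,x_p)$, $P_2=(y_1,\dots,y_p)$ be points of $\mathcal{S}^p$. Then there exists an integer $k\ge0$ with $F^k(P_1)=P_2$ if and only if there exist $k_1,\dots,k_p\in\{0,1\}$ such that the system of Diophantine equations \[2n_1m_1-x_1+(-1)^{k_1}y_1=2n_2m_2-x_2+(-1)^{k_2}y_2=\cdots=2n_pm_p-x_p+(-1)^{k_p}y_p\] has an integer solution $(n_1,\dots,n_p)$.
   Context: $\mathcal{S}^p=\{(x_1,\dots,x_p)\in\mathbb{Z}^p: 0\le x_i\le m_i,\ i=1,\dots,p\}$ is the $m_1\times\cdots\times m_p$ spatial grid. For a positive integer $m$ let $\varphi_m(u)=\min_{n\in\mathbb{Z}}|u-2nm|$ for $u\in\mathbb{Z}$ (the $2m$-periodic triangle wave with $\varphi_m(u)=u$ for $0\le u\le m$). For $k\in\mathbb{Z}$ put $f_i^k(x)=\varphi_{m_i}(x+k)$ and $F^k(x_1,\dots,x_p)=(f_1^k(x_1),\dots,f_p^k(x_p))$: the position after $k$ steps of a light beam started at the given point in direction $(+1,\dots,+1)$, moving along diagonals of unit cubes and reflecting in the mirror boundary of the box $\prod_i[0,m_i]$. "The light starting from $P_1$ passes through $P_2$" means $F^k(P_1)=P_2$ for some $k\ge0$. *)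

theory Defs
  imports Main "HOL-Library.FuncSet"
begin

text \<open>Points of \<open>\<int>\<^sup>p\<close> are extensional functions on the index set \<open>{1..p}\<close>
  (value \<open>undefined\<close> outside), so that equality of points is equality of functions.\<close>

definition grid :: "nat \<Rightarrow> (nat \<Rightarrow> int) \<Rightarrow> (nat \<Rightarrow> int) set" where
  "grid p m = (\<Pi>\<^sub>E i\<in>{1..p}. {0..m i})"

definition tri_wave :: "int \<Rightarrow> int \<Rightarrow> int" where
  "tri_wave m u = (LEAST d. \<exists>n::int. d = \<bar>u - 2 * n * m\<bar>)"

definition beam :: "nat \<Rightarrow> (nat \<Rightarrow> int) \<Rightarrow> int \<Rightarrow> (nat \<Rightarrow> int) \<Rightarrow> (nat \<Rightarrow> int)" where
  "beam p m k x = (\<lambda>i\<in>{1..p}. tri_wave (m i) (x i + k))"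

text \<open>\<open>LEAST\<close> on \<open>int\<close> is only meaningful if a least element exists; here it does.\<close>

lemma tri_wave_is_min:
  shows "\<exists>n. tri_wave m u = \<bar>u - 2 * n * m\<bar>"
    and "tri_wave m u \<le> \<bar>u - 2 * n * m\<bar>"
proof -
  obtain a :: int where a: "\<And>b. nat \<bar>u - 2 * a * m\<bar> \<le> nat \<bar>u - 2 * b * m\<bar>"
    using ex_has_least_nat[of "\<lambda>_. True" 0 "\<lambda>n. nat \<bar>u - 2 * n * m\<bar>"] by blast
  have le: "\<bar>u - 2 * a * m\<bar> \<le> \<bar>u - 2 * b * m\<bar>" for b
    using a[of b] by linarith
  have eq: "tri_wave m u = \<bar>u - 2 * a * m\<bar>"
    unfolding tri_wave_def by (rule Least_equality) (use le in blast)+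
  show "\<exists>n. tri_wave m u = \<bar>u - 2 * n * m\<bar>" using eq by blast
  show "tri_wave m u \<le> \<bar>u - 2 * n * m\<bar>" using eq le by simp
qed

end

(* At time k the i-th coordinate of the beam equals y i iff
   k = 2 * n i * m i - x i + (-1) ^ e i * y i for some integer n i and sign exponent e i, so the beam
   hits y iff these expressions share a nonnegative value for suitable n, e. A negative common value
   can be raised by multiples of 2 * (\<Prod>i. m i), a common period of all coordinates. *)

theory Submission
  imports Defs
begin

text \<open>The minimum defining the wave is attained at some \<open>n\<close>, and resolving the
  absolute value there gives the two signs. Conversely, \<open>y \<le> m\<close> makes
  \<open>2 * n * m\<close> a nearest multiple of \<open>2 * m\<close> to \<open>u\<close>, so its
  distance \<open>y\<close> is the minimum.\<close>

lemma tri_wave_eq_iff: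
  fixes m u y :: int
  assumes "m > 0" "0 \<le> y" "y \<le> m"
  shows "tri_wave m u = y \<longleftrightarrow> (\<exists>n. \<exists>e \<in> {0, 1::nat}. u = 2 * n * m + (-1) ^ e * y)"
proof
  assume "tri_wave m u = y"
  then obtain n where "y = \<bar>u - 2 * n * m\<bar>"
    using tri_wave_is_min(1) by metis
  then have "u = 2 * n * m + y \<or> u = 2 * n * m - y" by linarith
  then show "\<exists>n. \<exists>e \<in> {0, 1::nat}. u = 2 * n * m + (-1) ^ e * y" by auto
next
  assume "\<exists>n. \<exists>e \<in> {0, 1::nat}. u = 2 * n * m + (-1) ^ e * y"
  then obtain n where "u = 2 * n * m + y \<or> u = 2 * n * m - y" by auto
  then have n: "\<bar>u - 2 * n * m\<bar> = y" using assms(2) by linarith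
  obtain l where l: "tri_wave m u = \<bar>u - 2 * l * m\<bar>"
    using tri_wave_is_min(1) by blast
  have "y \<le> \<bar>u - 2 * l * m\<bar>"
  proof (cases "l = n")
    case False
    \<comment> \<open>Distinct multiples of \<open>2 * m\<close> are at least \<open>2 * m\<close>
      apart, so \<open>u\<close> lies at distance at least \<open>2 * m - y \<ge> y\<close> from
      \<open>2 * l * m\<close>.\<close>
    then have "1 * m \<le> \<bar>n - l\<bar> * m"
      using assms(1) by (intro mult_right_mono) auto
    also have "\<dots> = \<bar>n * m - l * m\<bar>"
      using assms(1) by (simp add: abs_mult flip: left_diff_distrib)
    finally show ?thesis using n assms(3) by linarith
  qed (use n in simp)
  moreover have "tri_wave m u \<le> y" using tri_wave_is_min(2)[of m u n] n by simp
  ultimately show "tri_wave m u = y" using l by linarith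
qed

text \<open>Membership of \<open>y\<close> in the grid serves twice: extensionality reduces equality
  of functions to equality on \<open>{1..p}\<close>, and the bounds
  \<open>0 \<le> y i \<le> m i\<close> allow \<open>tri_wave_eq_iff\<close> in each
  coordinate.\<close>

lemma beam_eq_iff:
  assumes "\<And>i. i \<in> {1..p} \<Longrightarrow> m i > 0" and y: "y \<in> grid p m"
  shows "beam p m k x = y \<longleftrightarrow>
    (\<forall>i\<in>{1..p}. \<exists>n. \<exists>e \<in> {0, 1::nat}. k = 2 * n * m i - x i + (-1) ^ e * y i)"
proof -
  have "beam p m k x = y \<longleftrightarrow> (\<forall>i\<in>{1..p}. tri_wave (m i) (x i + k) = y i)"
    using y by (auto simp: beam_def grid_def PiE_def extensional_def fun_eq_iff)
  also have "\<dots> \<longleftrightarrow>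
    (\<forall>i\<in>{1..p}. \<exists>n. \<exists>e \<in> {0, 1::nat}. x i + k = 2 * n * m i + (-1) ^ e * y i)"
    using assms by (intro ball_cong refl tri_wave_eq_iff) (auto simp: grid_def PiE_def Pi_def)
  also have "\<dots> \<longleftrightarrow>
    (\<forall>i\<in>{1..p}. \<exists>n. \<exists>e \<in> {0, 1::nat}. k = 2 * n * m i - x i + (-1) ^ e * y i)"
    by (intro ball_cong bex_cong arg_cong[where f = Ex] ext refl) linarith
  finally show ?thesis .
qed

theorem theorem4p3:
  fixes p :: nat and m x y :: "nat \<Rightarrow> int"
  assumes "p \<ge> 2"
    and "\<And>i. i \<in> {1..p} \<Longrightarrow> m i > 0"
    and "x \<in> grid p m"
    and "y \<in> grid p m"
  shows "(\<exists>k\<ge>0. beam p m k x = y) \<longleftrightarrow>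
    (\<exists>e :: nat \<Rightarrow> nat. (\<forall>i\<in>{1..p}. e i \<in> {0, 1}) \<and>
      (\<exists>n :: nat \<Rightarrow> int. \<forall>i\<in>{1..p}. \<forall>j\<in>{1..p}.
        2 * n i * m i - x i + (-1) ^ e i * y i = 2 * n j * m j - x j + (-1) ^ e j * y j))"
    (is "?L \<longleftrightarrow> ?R")
proof
  assume ?L
  then obtain k where "\<forall>i\<in>{1..p}. \<exists>n. \<exists>e \<in> {0, 1::nat}. k = 2 * n * m i - x i + (-1) ^ e * y i"
    using beam_eq_iff[OF assms(2,4)] by blast
  \<comment> \<open>Choice over the coordinates; the time \<open>k\<close> is then the common value
    of all the expressions.\<close>
  then obtain n e where "\<forall>i\<in>{1..p}. e i \<in> {0, 1::nat} \<and>
      k = 2 * n i * m i - x i + (-1) ^ e i * y i"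
    by metis
  then have "(\<forall>i\<in>{1..p}. e i \<in> {0, 1}) \<and> (\<forall>i\<in>{1..p}. \<forall>j\<in>{1..p}.
      2 * n i * m i - x i + (-1) ^ e i * y i = 2 * n j * m j - x j + (-1) ^ e j * y j)"
    by metis
  then show ?R by blast
next
  assume ?R
  then obtain e :: "nat \<Rightarrow> nat" and n where e: "\<forall>i\<in>{1..p}. e i \<in> {0, 1}"
    and n: "\<forall>i\<in>{1..p}. \<forall>j\<in>{1..p}.
      2 * n i * m i - x i + (-1) ^ e i * y i = 2 * n j * m j - x j + (-1) ^ e j * y j"
    by blast
  define c where "c = 2 * n 1 * m 1 - x 1 + (-1) ^ e 1 * y 1"
  have "1 \<in> {1..p}" using assms(1) by simp
  with n have c: "c = 2 * n i * m i - x i + (-1) ^ e i * y i" if "i \<in> {1..p}" for i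
    using that unfolding c_def by blast
  define M where "M = prod m {1..p}"
  \<comment> \<open>Since \<open>M \<ge> 1\<close>, the added term is at least
    \<open>2 * \<bar>c\<bar>\<close>, which outweighs a negative \<open>c\<close>.\<close>
  define k where "k = c + 2 * \<bar>c\<bar> * M"
  have "M > 0" unfolding M_def using assms(2) by (intro prod_pos) auto
  then have "\<bar>c\<bar> * 1 \<le> \<bar>c\<bar> * M" by (intro mult_left_mono) auto
  then have "k \<ge> 0" unfolding k_def by linarith
  moreover have "beam p m k x = y"
  proof (rule beam_eq_iff[THEN iffD2, OF assms(2,4)]; (intro ballI)?)
    fix i assume i: "i \<in> {1..p}"
    then have "m i dvd M" unfolding M_def by (intro dvd_prodI) auto
    then obtain q where "M = m i * q" by blast
    \<comment> \<open>The shift in time is absorbed by raising \<open>n i\<close> by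
      \<open>\<bar>c\<bar> * q\<close>; the sign exponent \<open>e i\<close> stays the same.\<close>
    then have "k = 2 * (n i + \<bar>c\<bar> * q) * m i - x i + (-1) ^ e i * y i"
      unfolding k_def using c[OF i] by (simp add: algebra_simps)
    then show "\<exists>n. \<exists>e \<in> {0, 1::nat}. k = 2 * n * m i - x i + (-1) ^ e * y i"
      using e i by blast
  qed
  ultimately show ?L by blast
qed

end
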